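(* Suppose that $M\in\mathbb R^{n\times n}$ is Hurwitz with distinct real eigenvalues $\lambda_1^M,\dots,\lambda_n^M$, and let $\Lambda_M=\mathrm{diag}(\lambda_1^M,\dots,\lambda_n^M)$. Given the plant $\dot x=Ax+Bu$, $y=Cx$, $x(0)=x_0$, there is a constant matrix $\Gamma\in\mathbb R^{n\times n}$ (not depending on $u$) such that for the system with state $\zeta\in\mathbb R^{n_\zeta}$, $n_\zeta=n_z+n$, $$\dot\zeta=\begin{bmatrix}A_\xi&L_zCT^{-1}\Gamma\\0_{n\times n_z}&\Lambda_M\end{bmatrix}\zeta+\begin{bmatrix}B_\xi\\0_{n\times m}\end{bmatrix}u,\quad \zeta(0)=\begin{bmatrix}0_{n_z}\\1_n\end{bmatrix},\qquad y_\zeta=[\,C_\xi\ \ CT^{-1}\Gamma\,]\zeta,$$ the following holds: for any input $u:\mathbb R_{\ge0}\to\mathbb R^m$ applied to both systems, the outputs satisfy $y_\zeta(t)=y(t)$ for all $t\ge0$.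
   Context: Setting: $x\in\mathbb R^n$, $u\in\mathbb R^m$, $y\in\mathbb R^p$; $A,B,C$ are constant real matrices, $(A,B)$ controllable, $(C,A)$ observable. Inputs are understood to be such that the differential equations have (Carathéodory) solutions, e.g. measurable and locally essentially bounded. $\mathrm{vec}$ stacks columns, $\otimes$ is the Kronecker product, $1_n$ is the all-ones vector. Filter: $\tilde n_z=(p+m)n$, $n_z=n^2(p+m)$, $Z\in\mathbb R^{n\times\tilde n_z}$, $\dot Z=MZ+[\,y^\top\otimes I_n\ \ u^\top\otimes I_n\,]$. With $z=\mathrm{vec}(Z)$ it reads $\dot z=A_zz+B_\xi u+L_zy$, where $$A_z=I_{\tilde n_z}\otimes M,\quad B_\xi=\begin{bmatrix}0_{pn^2\times m}\\ I_m\otimes\mathrm{vec}(I_n)\end{bmatrix},\quad L_z=\begin{bmatrix}I_p\otimes\mathrm{vec}(I_n)\\0_{mn^2\times p}\end{bmatrix}.$$ $T\in\mathbb R^{n\times n}$ (nonsingular) and $\theta\in\mathbb R^{\tilde n_z}$ are a fixed pair, depending only on the plant and $M$, such that $Tx(t)=Z(t)\theta+e^{Mt}(Tx_0-Z(0)\theta)$ for all $t\ge0$, all inputs and all initial conditions $x_0,Z(0)$ (such a pair is known to exist when $M$ is Hurwitz with distinct eigenvalues). Finally $C_\xi=C(\theta^\top\otimes T^{-1})$ and $A_\xi=A_z+L_zC_\xi$. *)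

theory Defs
  imports "HOL-Analysis.Analysis"
begin

section \<open>Block matrices, Kronecker products, vectorization\<close>

text \<open>
  Sizes are index types: a sum of types indexes stacked blocks, and a product of types, read
  lexicographically (first component outermost), indexes Kronecker products and vectorized
  matrices. So for \<open>X\<close> of size k by l, \<open>vec_stack X\<close> stacks columns: its first index
  component is the column.
\<close>

definition append_vec :: "real^'a \<Rightarrow> real^'b \<Rightarrow> real^('a + 'b)" where
  "append_vec v w = (\<chi> i. case i of Inl a \<Rightarrow> v $ a | Inr b \<Rightarrow> w $ b)"

definition vstack :: "real^'c^'a \<Rightarrow> real^'c^'b \<Rightarrow> real^'c^('a + 'b)" where
  "vstack X Y = (\<chi> i. case i of Inl a \<Rightarrow> X $ a | Inr b \<Rightarrow> Y $ b)"

definition hstack :: "real^'a^'r \<Rightarrow> real^'b^'r \<Rightarrow> real^('a + 'b)^'r" where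
  "hstack X Y = (\<chi> i. append_vec (X $ i) (Y $ i))"

definition kron :: "real^'b^'a \<Rightarrow> real^'d^'c \<Rightarrow> real^('b \<times> 'd)^('a \<times> 'c)" where
  "kron X Y = (\<chi> i j. X $ fst i $ fst j * Y $ snd i $ snd j)"

definition vec_stack :: "real^'l^'k \<Rightarrow> real^('l \<times> 'k)" where
  "vec_stack X = (\<chi> i. X $ snd i $ fst i)"

definition diag :: "real^'n \<Rightarrow> real^'n^'n" where
  "diag d = (\<chi> i j. if i = j then d $ i else 0)"

text \<open>
  Renames the row and column indices of a matrix along order-preserving bijections. It is used only
  to drop the one-element factor produced by a Kronecker product with a row or a column, and to
  pass between differently nested index types of the same size.
\<close>

definition reindex :: "('a \<Rightarrow> 'c) \<Rightarrow> ('b \<Rightarrow> 'd) \<Rightarrow> real^'d^'c \<Rightarrow> real^'b^'a" where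
  "reindex r c X = (\<chi> i j. X $ r i $ c j)"

section \<open>Spectrum and matrix exponential\<close>

definition complex_spectrum :: "real^'n^'n \<Rightarrow> complex set" where
  "complex_spectrum M =
    {\<mu>. \<exists>v :: complex^'n. v \<noteq> 0 \<and> (\<chi> i j. complex_of_real (M $ i $ j)) *v v = \<mu> *s v}"

definition hurwitz :: "real^'n^'n \<Rightarrow> bool" where
  "hurwitz M \<longleftrightarrow> (\<forall>\<mu>\<in>complex_spectrum M. Re \<mu> < 0)"

definition mat_exp :: "real^'n^'n \<Rightarrow> real^'n^'n" where
  "mat_exp M = (\<Sum>k. (1 / fact k) *\<^sub>R (((**) M ^^ k) (mat 1)))"

section \<open>Solutions of control systems\<close>

text \<open>
  A Caratheodory solution on the half-line \<open>t \<ge> 0\<close>, i.e. a locally absolutely continuous function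
  satisfying the differential equation almost everywhere, in the usual integrated form. Only the
  values at nonnegative times matter. The class of inputs is not fixed separately: the admissible
  inputs of a system are those for which it has a solution.
\<close>

definition caratheodory_solution ::
  "(real \<Rightarrow> 'a \<Rightarrow> 'a) \<Rightarrow> (real \<Rightarrow> 'a::euclidean_space) \<Rightarrow> bool" where
  "caratheodory_solution f x \<longleftrightarrow>
    (\<forall>t\<ge>0. (\<lambda>s. f s (x s)) absolutely_integrable_on {0..t} \<and>
           x t = x 0 + integral {0..t} (\<lambda>s. f s (x s)))"

definition linear_solution ::
  "real^'n^'n \<Rightarrow> real^'m^'n \<Rightarrow> (real \<Rightarrow> real^'m) \<Rightarrow> (real \<Rightarrow> real^'n) \<Rightarrow> bool" where
  "linear_solution A B u x \<longleftrightarrow> caratheodory_solution (\<lambda>t \<xi>. A *v \<xi> + B *v u t) x"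

definition controllable :: "real^'n^'n \<Rightarrow> real^'m^'n \<Rightarrow> bool" where
  "controllable A B \<longleftrightarrow>
    (\<forall>x\<^sub>0 x\<^sub>1. \<exists>t>0. \<exists>u x. linear_solution A B u x \<and> x 0 = x\<^sub>0 \<and> x t = x\<^sub>1)"

definition observable :: "real^'n^'p \<Rightarrow> real^'n^'n \<Rightarrow> bool" where
  "observable C A \<longleftrightarrow>
    (\<forall>x x'. caratheodory_solution (\<lambda>t \<xi>. A *v \<xi>) x \<longrightarrow>
            caratheodory_solution (\<lambda>t \<xi>. A *v \<xi>) x' \<longrightarrow>
            (\<forall>t\<ge>0. C *v x t = C *v x' t) \<longrightarrow> x 0 = x' 0)"

section \<open>The filter and the extended system\<close>

text \<open>The \<open>(p + m) n\<close> filter columns and the \<open>n\<^sup>2 (p + m)\<close> entries of the filter state.\<close>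

type_synonym ('n, 'm, 'p) filter_col = "('p \<times> 'n) + ('m \<times> 'n)"
type_synonym ('n, 'm, 'p) filter_ix = "('n, 'm, 'p) filter_col \<times> 'n"

definition regressor ::
  "real^'p \<Rightarrow> real^'m \<Rightarrow> real^(('n::finite, 'm::finite, 'p::finite) filter_col)^'n" where
  "regressor y u =
    reindex (\<lambda>i. (1, i)) id
      (hstack (kron (rowvector y :: real^'p^1) (mat 1 :: real^'n^'n))
              (kron (rowvector u :: real^'m^1) (mat 1 :: real^'n^'n)))"

definition filter_solution ::
  "real^'n^'n \<Rightarrow> (real \<Rightarrow> real^'p) \<Rightarrow> (real \<Rightarrow> real^'m) \<Rightarrow>
   (real \<Rightarrow> real^(('n::finite, 'm::finite, 'p::finite) filter_col)^'n) \<Rightarrow> bool" where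
  "filter_solution M y u Z \<longleftrightarrow>
    caratheodory_solution (\<lambda>t W. M ** W + regressor (y t) (u t)) Z"

definition A_z ::
  "real^'n^'n \<Rightarrow> real^(('n::finite, 'm::finite, 'p::finite) filter_ix)^(('n, 'm, 'p) filter_ix)" where
  "A_z M = kron (mat 1) M"

fun split_ix ::
  "('n, 'm, 'p) filter_ix \<Rightarrow> ('p \<times> ('n \<times> 'n)) + ('m \<times> ('n \<times> 'n))" where
  "split_ix (Inl (a, j), i) = Inl (a, (j, i))"
| "split_ix (Inr (b, j), i) = Inr (b, (j, i))"

definition vec_Id :: "real^1^('n::finite \<times> 'n)" where
  "vec_Id = columnvector (vec_stack (mat 1 :: real^'n^'n))"

definition B_xi :: "real^'m^(('n::finite, 'm::finite, 'p::finite) filter_ix)" where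
  "B_xi = reindex split_ix (\<lambda>j. (j, 1))
    (vstack (0 :: real^('m \<times> 1)^('p \<times> ('n \<times> 'n))) (kron (mat 1 :: real^'m^'m) vec_Id))"

definition L_z :: "real^'p^(('n::finite, 'm::finite, 'p::finite) filter_ix)" where
  "L_z = reindex split_ix (\<lambda>j. (j, 1))
    (vstack (kron (mat 1 :: real^'p^'p) vec_Id) (0 :: real^('p \<times> 1)^('m \<times> ('n \<times> 'n))))"

definition C_xi ::
  "real^'n^'p \<Rightarrow> real^'n^'n \<Rightarrow> real^(('n::finite, 'm::finite, 'p::finite) filter_col) \<Rightarrow>
   real^(('n, 'm, 'p) filter_ix)^'p" where
  "C_xi C T \<theta> = C ** reindex (\<lambda>i. (1, i)) id
    (kron (rowvector \<theta> :: real^(('n::finite, 'm::finite, 'p::finite) filter_col)^1) (matrix_inv T))"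

definition A_xi ::
  "real^'n^'n \<Rightarrow> real^'n^'p \<Rightarrow> real^'n^'n \<Rightarrow> real^(('n::finite, 'm::finite, 'p::finite) filter_col) \<Rightarrow>
   real^(('n, 'm, 'p) filter_ix)^(('n, 'm, 'p) filter_ix)" where
  "A_xi M C T \<theta> = A_z M + L_z ** C_xi C T \<theta>"

definition A_zeta ::
  "real^'n^'n \<Rightarrow> real^'n^'p \<Rightarrow> real^'n^'n \<Rightarrow> real^(('n::finite, 'm::finite, 'p::finite) filter_col) \<Rightarrow>
   real^'n^'n \<Rightarrow> real^'n^'n \<Rightarrow>
   real^(('n, 'm, 'p) filter_ix + 'n)^(('n, 'm, 'p) filter_ix + 'n)" where
  "A_zeta M C T \<theta> \<Lambda> \<Gamma> =
    vstack (hstack (A_xi M C T \<theta>) (L_z ** C ** matrix_inv T ** \<Gamma>))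
           (hstack 0 \<Lambda>)"

definition B_zeta :: "real^'m^(('n::finite, 'm::finite, 'p::finite) filter_ix + 'n)" where
  "B_zeta = vstack B_xi 0"

definition C_zeta ::
  "real^'n^'p \<Rightarrow> real^'n^'n \<Rightarrow> real^(('n::finite, 'm::finite, 'p::finite) filter_col) \<Rightarrow> real^'n^'n \<Rightarrow>
   real^(('n, 'm, 'p) filter_ix + 'n)^'p" where
  "C_zeta C T \<theta> \<Gamma> = hstack (C_xi C T \<theta>) (C ** matrix_inv T ** \<Gamma>)"

text \<open>The matrix and the vectorized form of the filter agree.\<close>

lemma vec_stack_filter:
  fixes M :: "real^'n^'n" and Z :: "real^(('n::finite, 'm::finite, 'p::finite) filter_col)^'n"
    and y :: "real^'p" and u :: "real^'m"
  shows "vec_stack (M ** Z + regressor y u) = A_z M *v vec_stack Z + B_xi *v u + L_z *v y"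
proof -
  have *: "vec_stack (M ** Z) = A_z M *v vec_stack Z"
  proof (simp only: vec_eq_iff, intro allI)
    fix i :: "('n, 'm, 'p) filter_ix"
    obtain c k where i: "i = (c, k)" by (cases i)
    have "(A_z M *v vec_stack Z) $ i =
      (\<Sum>j\<in>UNIV \<times> UNIV. (if c = fst j then 1 else 0) * M $ k $ snd j * Z $ snd j $ fst j)"
      by (simp add: i A_z_def kron_def vec_stack_def matrix_vector_mult_def mat_def)
    also have "\<dots> = (\<Sum>c'\<in>UNIV. \<Sum>l\<in>UNIV. (if c = c' then 1 else 0) * M $ k $ l * Z $ l $ c')"
      by (simp add: sum.cartesian_product split_beta)
    also have "\<dots> = (\<Sum>c'\<in>UNIV. if c = c' then (\<Sum>l\<in>UNIV. M $ k $ l * Z $ l $ c') else 0)"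
      by (intro sum.cong) auto
    also have "\<dots> = (\<Sum>l\<in>UNIV. M $ k $ l * Z $ l $ c)"
      by simp
    finally show "vec_stack (M ** Z) $ i = (A_z M *v vec_stack Z) $ i"
      by (simp add: i vec_stack_def matrix_matrix_mult_def)
  qed
  have **: "vec_stack (regressor y u :: real^(('n, 'm, 'p) filter_col)^'n)
      = B_xi *v u + L_z *v y"
  proof (simp only: vec_eq_iff, intro allI)
    fix i :: "('n, 'm, 'p) filter_ix"
    have ite: "(if P then a else (0::real)) * b = (if P then a * b else 0)" for P a b
      by simp
    show "vec_stack (regressor y u) $ i = (B_xi *v u + L_z *v y) $ i"
    proof (cases i rule: split_ix.cases)
      case (1 a j k)
      then show ?thesis
        by (simp add: vec_stack_def regressor_def reindex_def hstack_def append_vec_def kron_def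
            rowvector_def columnvector_def B_xi_def L_z_def vec_Id_def vstack_def mat_def
            matrix_vector_mult_def ite)
    next
      case (2 b j k)
      then show ?thesis
        by (simp add: vec_stack_def regressor_def reindex_def hstack_def append_vec_def kron_def
            rowvector_def columnvector_def B_xi_def L_z_def vec_Id_def vstack_def mat_def
            matrix_vector_mult_def ite)
    qed
  qed
  have "vec_stack (M ** Z + regressor y u) = vec_stack (M ** Z) + vec_stack (regressor y u)"
    by (simp add: vec_stack_def vec_eq_iff)
  then show ?thesis by (simp add: * ** add.assoc)
qed

end

theory Submission
  imports Defs
begin

text \<open>
  Write \<open>\<zeta> = (z, w)\<close> with \<open>z = vec Y\<close>, let \<open>y\<^sub>\<zeta>\<close> be the output of the extended
  system and \<open>y\<close> that of the plant. The extended system is built so that \<open>Y\<close> is a solution of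
  the filter, but driven by \<open>(y\<^sub>\<zeta>, u)\<close> instead of \<open>(y, u)\<close>, while
  \<open>y\<^sub>\<zeta> = C T\<inverse> (Y \<theta> + \<Gamma> w)\<close> (lemmas \<open>extended_solution_blocks\<close> and
  \<open>C_zeta_mult_vec\<close>). Since \<open>M\<close> has distinct real eigenvalues, \<open>M = V \<Lambda> V\<inverse>\<close> over the
  reals, and with \<open>\<Gamma> = V diag(V\<inverse> T x\<^sub>0)\<close> one gets
  \<open>\<Gamma> w(t) = \<Gamma> e\<^sup>\<Lambda>\<^sup>t 1 = e\<^sup>M\<^sup>t T x\<^sub>0\<close>, which is exactly the transient in the identity
  \<open>T x = Z \<theta> + e\<^sup>M\<^sup>t T x\<^sub>0\<close> for filters started at zero.

  The true filter is compared with \<open>Y\<close> through the output error \<open>e = y - y\<^sub>\<zeta>\<close>. It is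
  continuous even for irregular inputs, so \<open>\<dot>D = M D + [e\<^sup>T \<otimes> I, 0]\<close>, \<open>D(0) = 0\<close> has a
  classical solution (\<open>matrix_ode_continuous_forcing\<close>), and \<open>Z = Y + D\<close> solves the filter for
  \<open>(y, u)\<close>. The identity for \<open>T x\<close> then gives
  \<open>e = C T\<inverse> D \<theta>\<close>. Hence \<open>D\<close> satisfies a homogeneous linear equation with zero initial
  value, so \<open>D = 0\<close> (\<open>caratheodory_linear_zero\<close>) and \<open>e = 0\<close>.
\<close>

section \<open>Caratheodory solutions\<close>

text \<open>
  Destruction rules, because unfolding the definition gives the simplifier a looping equation: its
  right-hand side contains \<open>x 0\<close>, an instance of the left-hand side.
\<close>

lemma caratheodory_solutionD:
  assumes "caratheodory_solution f x" and "t \<ge> 0"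
  shows "(\<lambda>s. f s (x s)) absolutely_integrable_on {0..t}"
    and "x t = x 0 + integral {0..t} (\<lambda>s. f s (x s))"
  using assms unfolding caratheodory_solution_def by blast+

lemma caratheodory_continuous:
  assumes "caratheodory_solution f x"
  shows "continuous_on {0..b} x"
proof (cases "b \<ge> 0")
  case True
  then have "(\<lambda>s. f s (x s)) integrable_on {0..b}"
    using caratheodory_solutionD(1)[OF assms] set_lebesgue_integral_eq_integral(1) by blast
  then have "continuous_on {0..b} (\<lambda>t. x 0 + integral {0..t} (\<lambda>s. f s (x s)))"
    by (intro continuous_intros indefinite_integral_continuous_1)
  then show ?thesis
    by (rule continuous_on_eq) (simp add: caratheodory_solutionD(2)[OF assms, symmetric])
qed simp

text \<open>
  The hypothesis on \<open>g\<close> concerns only the points of the trajectory. So \<open>h\<close> may forget part of the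
  state, with \<open>g\<close> treating the lost part as a function of time; and \<open>h\<close> may be the identity, which
  exchanges one vector field for another that agrees with it along the trajectory.
\<close>

lemma caratheodory_linear_image:
  assumes x: "caratheodory_solution f x" and h: "bounded_linear h"
    and g: "\<And>t. t \<ge> 0 \<Longrightarrow> g t (h (x t)) = h (f t (x t))"
  shows "caratheodory_solution g (\<lambda>t. h (x t))"
  unfolding caratheodory_solution_def
proof (intro allI impI)
  fix t :: real assume t: "t \<ge> 0"
  have int: "(\<lambda>s. f s (x s)) absolutely_integrable_on {0..t}"
    and xt: "x t = x 0 + integral {0..t} (\<lambda>s. f s (x s))"
    by (rule caratheodory_solutionD[OF x t])+
  have "(h \<circ> (\<lambda>s. f s (x s))) absolutely_integrable_on {0..t}"
    by (rule absolutely_integrable_linear[OF int h])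
  moreover have "(\<lambda>s. g s (h (x s))) absolutely_integrable_on {0..t} \<longleftrightarrow>
      (h \<circ> (\<lambda>s. f s (x s))) absolutely_integrable_on {0..t}"
    by (rule set_integrable_cong) (auto simp: g)
  moreover have "integral {0..t} (\<lambda>s. g s (h (x s))) = integral {0..t} (h \<circ> (\<lambda>s. f s (x s)))"
    by (rule integral_cong) (simp add: g)
  moreover have "\<dots> = h (integral {0..t} (\<lambda>s. f s (x s)))"
    by (rule integral_linear[OF set_lebesgue_integral_eq_integral(1)[OF int] h])
  ultimately show "(\<lambda>s. g s (h (x s))) absolutely_integrable_on {0..t} \<and>
      h (x t) = h (x 0) + integral {0..t} (\<lambda>s. g s (h (x s)))"
    by (subst xt) (simp add: linear_add[OF bounded_linear.linear[OF h]])
qed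

text \<open>Superposition, again required of the right-hand sides along the trajectories only.\<close>

lemma caratheodory_add:
  assumes x: "caratheodory_solution f x" and y: "caratheodory_solution g y"
    and h: "\<And>t. t \<ge> 0 \<Longrightarrow> h t (x t + y t) = f t (x t) + g t (y t)"
  shows "caratheodory_solution h (\<lambda>t. x t + y t)"
  unfolding caratheodory_solution_def
proof (intro allI impI)
  fix t :: real assume t: "t \<ge> 0"
  have fx: "(\<lambda>s. f s (x s)) absolutely_integrable_on {0..t}"
    and xt: "x t = x 0 + integral {0..t} (\<lambda>s. f s (x s))"
    by (rule caratheodory_solutionD[OF x t])+
  have gy: "(\<lambda>s. g s (y s)) absolutely_integrable_on {0..t}"
    and yt: "y t = y 0 + integral {0..t} (\<lambda>s. g s (y s))"
    by (rule caratheodory_solutionD[OF y t])+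
  have "(\<lambda>s. f s (x s) + g s (y s)) absolutely_integrable_on {0..t}"
    using fx gy by (rule set_integral_add)
  moreover have "(\<lambda>s. h s (x s + y s)) absolutely_integrable_on {0..t} \<longleftrightarrow>
      (\<lambda>s. f s (x s) + g s (y s)) absolutely_integrable_on {0..t}"
    by (rule set_integrable_cong) (auto simp: h)
  moreover have "integral {0..t} (\<lambda>s. h s (x s + y s)) =
      integral {0..t} (\<lambda>s. f s (x s) + g s (y s))"
    by (rule integral_cong) (simp add: h)
  moreover have "\<dots> = integral {0..t} (\<lambda>s. f s (x s)) + integral {0..t} (\<lambda>s. g s (y s))"
    by (rule integral_add) (rule set_lebesgue_integral_eq_integral(1)[OF fx],
        rule set_lebesgue_integral_eq_integral(1)[OF gy])
  ultimately show "(\<lambda>s. h s (x s + y s)) absolutely_integrable_on {0..t} \<and>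
      x t + y t = x 0 + y 0 + integral {0..t} (\<lambda>s. h s (x s + y s))"
    by (subst xt, subst yt) simp
qed

lemma classical_imp_caratheodory:
  assumes d: "\<And>b t. 0 \<le> t \<Longrightarrow> t \<le> b \<Longrightarrow>
      (x has_vector_derivative f t (x t)) (at t within {0..b})"
    and c: "\<And>b. continuous_on {0..b} (\<lambda>t. f t (x t))"
  shows "caratheodory_solution f x"
  unfolding caratheodory_solution_def
proof (intro allI impI conjI)
  fix t :: real assume t: "t \<ge> 0"
  show "(\<lambda>s. f s (x s)) absolutely_integrable_on {0..t}"
    by (rule absolutely_integrable_continuous_real[OF c])
  have "((\<lambda>s. f s (x s)) has_integral (x t - x 0)) {0..t}"
    using t by (rule fundamental_theorem_of_calculus) (auto intro: d)
  then show "x t = x 0 + integral {0..t} (\<lambda>s. f s (x s))"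
    by (simp add: integral_unique)
qed

text \<open>
  Uniqueness by an energy estimate: a solution of an autonomous linear equation is continuously
  differentiable, and if \<open>K\<close> bounds \<open>F\<close> then \<open>e\<^sup>-\<^sup>2\<^sup>K\<^sup>t \<bar>x(t)\<bar>\<^sup>2\<close> has a nonpositive derivative.
\<close>

lemma caratheodory_linear_zero:
  fixes x :: "real \<Rightarrow> 'a::euclidean_space"
  assumes x: "caratheodory_solution (\<lambda>t. F) x" and F: "bounded_linear F"
    and x0: "x 0 = 0" and t: "t \<ge> 0"
  shows "x t = 0"
proof -
  obtain K where K: "\<And>v. norm (F v) \<le> norm v * K"
    using bounded_linear.bounded[OF F] by blast
  have xc: "continuous_on {0..t} x"
    by (rule caratheodory_continuous[OF x])
  have Fc: "continuous_on {0..t} (\<lambda>s. F (x s))"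
    by (rule bounded_linear.continuous_on[OF F xc])
  have xi: "x r = integral {0..r} (\<lambda>s. F (x s))" if "r \<ge> 0" for r
    using caratheodory_solutionD(2)[OF x that] by (metis x0 add_0)
  have dx: "(x has_vector_derivative F (x s)) (at s)" if "0 < s" "s < t" for s
  proof -
    have "((\<lambda>r. integral {0..r} (\<lambda>s. F (x s))) has_vector_derivative F (x s)) (at s within {0..t})"
      using Fc by (rule integral_has_vector_derivative) (use that in auto)
    then have "(x has_vector_derivative F (x s)) (at s within {0..t})"
      by (rule has_vector_derivative_transform[rotated 2])
        (use that xi in simp_all)
    then show ?thesis
      using that at_within_Icc_at[of 0 s t] by simp
  qed
  \<comment> \<open>The factor 2 compensates the derivative \<open>2 (x \<bullet> F x) \<le> 2 K (x \<bullet> x)\<close> of the squared norm.\<close>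
  define \<phi> where "\<phi> s = exp (- 2 * K * s) * (x s \<bullet> x s)" for s
  have "\<phi> t \<le> \<phi> 0"
    using t
  proof (rule DERIV_nonpos_imp_decreasing_open)
    show "continuous_on {0..t} \<phi>"
      unfolding \<phi>_def by (intro continuous_intros xc)
    fix s assume s: "0 < s" "s < t"
    have dd: "((\<lambda>s. x s \<bullet> x s) has_real_derivative 2 * (x s \<bullet> F (x s))) (at s)"
      using has_derivative_inner[OF dx[OF s, unfolded has_vector_derivative_def]
          dx[OF s, unfolded has_vector_derivative_def]]
      by (rule has_derivative_imp_has_field_derivative) (simp add: inner_commute)
    have "(\<phi> has_real_derivative exp (- 2 * K * s) * (2 * (x s \<bullet> F (x s)))
        + exp (- 2 * K * s) * (- 2 * K) * (x s \<bullet> x s)) (at s)"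
      unfolding \<phi>_def by (rule derivative_eq_intros dd refl | simp)+
    moreover have "x s \<bullet> F (x s) \<le> norm (x s) * (norm (x s) * K)"
      by (rule order_trans[OF norm_cauchy_schwarz]) (simp add: K mult_left_mono)
    then have "x s \<bullet> F (x s) \<le> K * (x s \<bullet> x s)"
      by (simp add: dot_square_norm power2_eq_square mult_ac)
    then have "exp (- 2 * K * s) * (2 * (x s \<bullet> F (x s)) - 2 * K * (x s \<bullet> x s)) \<le> 0"
      by (intro mult_nonneg_nonpos) auto
    then have "exp (- 2 * K * s) * (2 * (x s \<bullet> F (x s)))
        + exp (- 2 * K * s) * (- 2 * K) * (x s \<bullet> x s) \<le> 0"
      by (simp add: algebra_simps)
    ultimately show "\<exists>y. DERIV \<phi> s :> y \<and> y \<le> 0" by blast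
  qed
  then have "exp (- 2 * K * t) * (x t \<bullet> x t) \<le> 0"
    by (simp add: \<phi>_def x0)
  then have "x t \<bullet> x t \<le> 0"
    by (simp add: mult_le_0_iff)
  then show ?thesis
    by (metis inner_eq_zero_iff inner_ge_zero order_antisym)
qed

section \<open>Real diagonalization and the matrix exponential\<close>

text \<open>The real and imaginary parts of a complex eigenvector are both eigenvectors, or zero.\<close>

lemma real_eigenvector:
  fixes M :: "real^'n^'n"
  assumes "complex_of_real r \<in> complex_spectrum M"
  obtains v :: "real^'n" where "v \<noteq> 0" "M *v v = r *\<^sub>R v"
proof -
  obtain v :: "complex^'n" where v: "v \<noteq> 0"
    "(\<chi> i j. complex_of_real (M $ i $ j)) *v v = complex_of_real r *s v"
    using assms unfolding complex_spectrum_def by auto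
  have eq: "(\<Sum>j\<in>UNIV. complex_of_real (M $ i $ j) * v $ j) = complex_of_real r * v $ i" for i
    using arg_cong[OF v(2), of "\<lambda>w. w $ i"] by (simp add: matrix_vector_mult_def)
  have re: "M *v (\<chi> j. Re (v $ j)) = r *\<^sub>R (\<chi> j. Re (v $ j))"
    using arg_cong[OF eq, of Re] by (simp add: vec_eq_iff matrix_vector_mult_def)
  have im: "M *v (\<chi> j. Im (v $ j)) = r *\<^sub>R (\<chi> j. Im (v $ j))"
    using arg_cong[OF eq, of Im] by (simp add: vec_eq_iff matrix_vector_mult_def)
  have "(\<chi> j. Re (v $ j)) \<noteq> 0 \<or> (\<chi> j. Im (v $ j)) \<noteq> 0"
    using v(1) by (auto simp: vec_eq_iff complex_eq_iff)
  with re im that show ?thesis by blast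
qed

text \<open>
  Applying \<open>M - \<lambda>\<^sub>j\<close> to a linear relation removes its \<open>j\<close>-th term and multiplies every other
  coefficient by the nonzero number \<open>\<lambda>\<^sub>k - \<lambda>\<^sub>j\<close>.
\<close>

lemma eigenvectors_independent:
  fixes M :: "real^'n^'n" and v :: "'k \<Rightarrow> real^'n"
  assumes "finite S" and inj: "inj_on lam S"
    and v: "\<And>k. k \<in> S \<Longrightarrow> v k \<noteq> 0" "\<And>k. k \<in> S \<Longrightarrow> M *v v k = lam k *\<^sub>R v k"
    and "(\<Sum>k\<in>S. c k *\<^sub>R v k) = 0" and "k \<in> S"
  shows "c k = 0"
  using assms
proof (induction S arbitrary: c k rule: finite_induct)
  case (insert j S)
  have cancel: "X - Y = 0" if "a + X = 0" "a + Y = 0" for a X Y :: "real^'n"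
    using that by (simp add: add_eq_0_iff)
  have sum: "c j *\<^sub>R v j + (\<Sum>k\<in>S. c k *\<^sub>R v k) = 0"
    using insert.prems(4) insert.hyps by simp
  have "M *v (c j *\<^sub>R v j + (\<Sum>k\<in>S. c k *\<^sub>R v k)) = 0"
    by (simp add: sum)
  then have "(c j * lam j) *\<^sub>R v j + (\<Sum>k\<in>S. (c k * lam k) *\<^sub>R v k) = 0"
    using insert.prems(3) by (simp add: matrix_vector_right_distrib matrix_vector_mult_scaleR
        linear_sum[OF matrix_vector_mul_linear])
  moreover have "(c j * lam j) *\<^sub>R v j + (\<Sum>k\<in>S. (lam j * c k) *\<^sub>R v k) = 0"
    using arg_cong[OF sum, of "\<lambda>w. lam j *\<^sub>R w"]
    by (simp add: scaleR_add_right scaleR_sum_right mult.commute)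
  ultimately have "(\<Sum>k\<in>S. (c k * lam k) *\<^sub>R v k) - (\<Sum>k\<in>S. (lam j * c k) *\<^sub>R v k) = 0"
    by (rule cancel)
  then have *: "(\<Sum>k\<in>S. (c k * (lam k - lam j)) *\<^sub>R v k) = 0"
    by (simp add: sum_subtractf right_diff_distrib scaleR_left_diff_distrib mult.commute)
  have "c k * (lam k - lam j) = 0" if "k \<in> S" for k
    by (rule insert.IH[OF _ _ _ * that]) (use insert.prems(1-3) in auto)
  then have S: "c k = 0" if "k \<in> S" for k
    using that inj_onD[OF insert.prems(1), of k j] insert.hyps(2) by force
  then have "c j *\<^sub>R v j = 0" using sum by simp
  then have "c j = 0" using insert.prems(2) by auto
  then show ?case using S insert.prems(5) by auto
qed simp

lemma distinct_real_eigenvalues_diagonalize: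
  fixes M :: "real^'n^'n"
  assumes inj: "inj (\<lambda>i. lam $ i)"
    and spec: "range (\<lambda>i. complex_of_real (lam $ i)) \<subseteq> complex_spectrum M"
  obtains V W :: "real^'n^'n" where "V ** W = mat 1" "W ** V = mat 1" "M = V ** diag lam ** W"
proof -
  have "\<exists>v. v \<noteq> 0 \<and> M *v v = (lam $ i) *\<^sub>R v" for i
    using real_eigenvector[of "lam $ i" M] spec by blast
  then obtain v where v: "\<And>i. v i \<noteq> 0" "\<And>i. M *v v i = (lam $ i) *\<^sub>R v i"
    by metis
  define V :: "real^'n^'n" where "V = (\<chi> r i. v i $ r)"
  have colV: "column i V = v i" for i
    by (simp add: V_def column_def)
  have "c = 0" if "V *v c = 0" for c
  proof -
    have sum: "(\<Sum>i\<in>UNIV. c $ i *\<^sub>R v i) = 0"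
      using that by (simp add: matrix_mult_sum colV scalar_mult_eq_scaleR)
    have "c $ i = 0" for i
      by (rule eigenvectors_independent[OF finite inj v(1) v(2) sum]) auto
    then show ?thesis by (simp add: vec_eq_iff)
  qed
  then obtain W where WV: "W ** V = mat 1"
    using matrix_left_invertible_ker[of V] by auto
  then have VW: "V ** W = mat 1"
    by (rule matrix_left_right_inverse[THEN iffD1])
  have "M ** V = V ** diag lam"
  proof -
    have "(M *v v j) $ i = (M ** V) $ i $ j" for i j
      by (simp add: matrix_vector_mult_def matrix_matrix_mult_def V_def)
    moreover have "(V ** diag lam) $ i $ j = (lam $ j *\<^sub>R v j) $ i" for i j
      by (simp add: matrix_matrix_mult_def V_def diag_def if_distrib cong: if_cong)
    ultimately show ?thesis by (simp add: vec_eq_iff v(2))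
  qed
  then have "M = V ** diag lam ** W"
    using VW matrix_mul_assoc[of M V W] by simp
  with VW WV that show ?thesis by blast
qed

lemma bounded_linear_matrix_mult_left: "bounded_linear (\<lambda>X :: real^'c^'b. (P :: real^'b^'a) ** X)"
  unfolding linear_conv_bounded_linear[symmetric]
  by (intro linearI) (simp_all add: vec_eq_iff matrix_matrix_mult_def
      distrib_left sum.distrib sum_distrib_left mult.left_commute)

lemma bounded_linear_matrix_mult_right: "bounded_linear (\<lambda>X :: real^'b^'a. X ** (P :: real^'c^'b))"
  unfolding linear_conv_bounded_linear[symmetric]
  by (intro linearI) (simp_all add: vec_eq_iff matrix_matrix_mult_def
      distrib_right sum.distrib sum_distrib_left mult.assoc)

lemma bounded_linear_diag: "bounded_linear diag"
  unfolding linear_conv_bounded_linear[symmetric]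
  by (intro linearI) (simp_all add: diag_def vec_eq_iff)

lemma diag_mult_vec: "diag d *v v = (\<chi> i. d $ i * v $ i)"
proof -
  have "(if P then x else (0::real)) * y = (if P then x * y else 0)" for P x y
    by simp
  then show ?thesis
    by (simp add: vec_eq_iff matrix_vector_mult_def diag_def)
qed

lemma diag_matrix_mult_nth: "(diag d ** X) $ i $ j = d $ i * X $ i $ j"
proof -
  have "(if P then x else (0::real)) * y = (if P then x * y else 0)" for P x y
    by simp
  then show ?thesis
    by (simp add: matrix_matrix_mult_def diag_def)
qed

lemma diag_mult: "diag a ** diag b = diag (\<chi> i. a $ i * b $ i)"
  by (simp add: vec_eq_iff diag_matrix_mult_nth) (simp add: diag_def)

text \<open>
  The \<open>k\<close>-th power of the diagonalized matrix is the image of the entrywise \<open>k\<close>-th powers under the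
  bounded linear map \<open>e \<mapsto> V diag(e) W\<close>, which carries the scalar exponential series over.
\<close>

lemma mat_exp_diagonalized:
  fixes V W :: "real^'n^'n"
  assumes VW: "V ** W = mat 1" and WV: "W ** V = mat 1"
  shows "mat_exp (V ** diag d ** W) = V ** diag (\<chi> i. exp (d $ i)) ** W"
proof -
  let ?M = "V ** diag d ** W"
  let ?h = "\<lambda>e. V ** diag e ** W"
  have h: "bounded_linear ?h"
    using bounded_linear_compose[OF bounded_linear_matrix_mult_right
        bounded_linear_compose[OF bounded_linear_matrix_mult_left bounded_linear_diag]] .
  have pow: "((**) ?M ^^ k) (mat 1) = ?h (\<chi> i. (d $ i) ^ k)" for k
  proof (induction k)
    case 0
    have "diag (\<chi> i. 1) = (mat 1 :: real^'n^'n)" by (simp add: diag_def mat_def vec_eq_iff)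
    then show ?case by (simp add: VW)
  next
    case (Suc k)
    have "((**) ?M ^^ Suc k) (mat 1) = V ** diag d ** (W ** V) ** diag (\<chi> i. (d $ i) ^ k) ** W"
      by (simp add: Suc matrix_mul_assoc)
    also have "\<dots> = V ** (diag d ** diag (\<chi> i. (d $ i) ^ k)) ** W"
      by (simp add: WV matrix_mul_assoc)
    finally show ?case by (simp add: diag_mult)
  qed
  have "(\<lambda>k. (\<chi> i. (d $ i) ^ k /\<^sub>R fact k)) sums (\<chi> i. exp (d $ i))"
    unfolding sums_def
    by (rule vec_tendstoI) (simp add: exp_converges[where 'a=real, unfolded sums_def real_scaleR_def])
  from bounded_linear.sums[OF h this]
  have "(\<lambda>k. (1 / fact k) *\<^sub>R (((**) ?M ^^ k) (mat 1))) sums ?h (\<chi> i. exp (d $ i))"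
  proof (rule sums_cong[THEN iffD1, rotated])
    fix k
    have "?h (\<chi> i. (d $ i) ^ k /\<^sub>R fact k) = ?h ((1 / fact k) *\<^sub>R (\<chi> i. (d $ i) ^ k))"
      by (rule arg_cong[of _ _ ?h]) (simp add: vec_eq_iff divide_inverse)
    also have "\<dots> = (1 / fact k) *\<^sub>R ?h (\<chi> i. (d $ i) ^ k)"
      by (rule linear_scale[OF bounded_linear.linear[OF h]])
    finally show "?h (\<chi> i. (d $ i) ^ k /\<^sub>R fact k) = (1 / fact k) *\<^sub>R (((**) ?M ^^ k) (mat 1))"
      by (simp add: pow)
  qed
  then show ?thesis
    unfolding mat_exp_def by (rule sums_unique[symmetric])
qed

section \<open>Explicitly solvable linear equations\<close>

lemma has_vector_derivative_vecI:
  assumes "\<And>i. ((\<lambda>t. f t $ i) has_vector_derivative f' $ i) (at t within S)"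
  shows "(f has_vector_derivative f') (at t within S)"
proof -
  have "((\<lambda>s. (f s - f t - (s - t) *\<^sub>R f') /\<^sub>R norm (s - t)) \<longlongrightarrow> 0) (at t within S)"
  proof (rule vec_tendstoI)
    fix i
    show "((\<lambda>s. ((f s - f t - (s - t) *\<^sub>R f') /\<^sub>R norm (s - t)) $ i) \<longlongrightarrow> 0 $ i) (at t within S)"
      using assms[of i] by (simp add: has_vector_derivative_def has_derivative_at_within)
  qed
  then show ?thesis
    by (simp add: has_vector_derivative_def has_derivative_at_within bounded_linear_scaleR_left)
qed

lemma scalar_variation_of_constants:
  fixes h :: "real \<Rightarrow> real" and l :: real
  assumes h: "continuous_on {0..b} h" and t: "0 \<le> t" "t \<le> b"
  defines "r \<equiv> \<lambda>t. exp (l * t) * integral {0..t} (\<lambda>s. exp (- l * s) * h s)"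
  shows "(r has_vector_derivative l * r t + h t) (at t within {0..b})"
proof -
  have "continuous_on {0..b} (\<lambda>s. exp (- l * s) * h s)"
    by (intro continuous_intros h)
  then have d: "((\<lambda>t. integral {0..t} (\<lambda>s. exp (- l * s) * h s))
      has_real_derivative exp (- l * t) * h t) (at t within {0..b})"
    unfolding has_real_derivative_iff_has_vector_derivative
    by (rule integral_has_vector_derivative) (use t in auto)
  have e: "((\<lambda>t. exp (l * t)) has_real_derivative exp (l * t) * l) (at t within {0..b})"
    by (rule derivative_eq_intros refl | simp)+
  have "exp (l * t) * l * integral {0..t} (\<lambda>s. exp (- l * s) * h s)
      + exp (- l * t) * h t * exp (l * t) = l * r t + h t"
    by (simp add: r_def exp_minus)
  from DERIV_cong[OF DERIV_mult[OF e d] this] show ?thesis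
    unfolding has_real_derivative_iff_has_vector_derivative[symmetric] r_def .
qed

text \<open>
  In the eigenbasis the equation decouples into scalar equations, one for every entry of
  \<open>W D\<close>, each solved by variation of constants.
\<close>

lemma matrix_ode_continuous_forcing:
  fixes V W :: "real^'n^'n" and G :: "real \<Rightarrow> real^'c^'n"
  assumes VW: "V ** W = mat 1" and WV: "W ** V = mat 1"
    and G: "\<And>b. continuous_on {0..b} G"
  obtains D where "caratheodory_solution (\<lambda>t X. (V ** diag lam ** W) ** X + G t) D" and "D 0 = 0"
proof -
  define r where "r i c t =
    exp (lam $ i * t) * integral {0..t} (\<lambda>s. exp (- (lam $ i) * s) * (W ** G s) $ i $ c)" for i c t
  define R where "R t = (\<chi> i c. r i c t)" for t
  have WG: "continuous_on {0..b} (\<lambda>s. W ** G s)" for b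
    by (rule bounded_linear.continuous_on[OF bounded_linear_matrix_mult_left G])
  have dR: "(R has_vector_derivative diag lam ** R t + W ** G t) (at t within {0..b})"
    if "0 \<le> t" "t \<le> b" for t b
  proof (intro has_vector_derivative_vecI)
    fix i c
    have "(r i c has_vector_derivative lam $ i * r i c t + (W ** G t) $ i $ c) (at t within {0..b})"
      unfolding r_def
      by (rule scalar_variation_of_constants) (use that in \<open>auto intro!: continuous_intros WG\<close>)
    moreover have "(diag lam ** R t) $ i $ c = lam $ i * r i c t"
      by (simp add: diag_matrix_mult_nth R_def)
    ultimately show "((\<lambda>t. R t $ i $ c) has_vector_derivative
        (diag lam ** R t + W ** G t) $ i $ c) (at t within {0..b})"
      by (simp add: R_def)
  qed
  have dD: "((\<lambda>t. V ** R t) has_vector_derivative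
      (V ** diag lam ** W) ** (V ** R t) + G t) (at t within {0..b})"
    if "0 \<le> t" "t \<le> b" for t b
  proof -
    have "(V ** diag lam ** W) ** (V ** R t) = V ** diag lam ** (W ** V) ** R t"
      by (simp only: matrix_mul_assoc)
    then have "(V ** diag lam ** W) ** (V ** R t) + G t = V ** (diag lam ** R t) + (V ** W) ** G t"
      by (simp add: VW WV matrix_mul_assoc)
    also have "\<dots> = V ** (diag lam ** R t + W ** G t)"
      by (simp only: matrix_add_ldistrib matrix_mul_assoc)
    finally show ?thesis
      using bounded_linear.has_vector_derivative[OF bounded_linear_matrix_mult_left dR[OF that], of V]
      by simp
  qed
  have "continuous_on {0..b} (\<lambda>t. V ** R t)" for b
    by (rule continuous_on_vector_derivative[OF dD]) auto
  then have "continuous_on {0..b} (\<lambda>t. (V ** diag lam ** W) ** (V ** R t) + G t)" for b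
    by (rule continuous_on_add[OF bounded_linear.continuous_on[OF bounded_linear_matrix_mult_left] G])
  with dD have "caratheodory_solution (\<lambda>t X. (V ** diag lam ** W) ** X + G t) (\<lambda>t. V ** R t)"
    by (intro classical_imp_caratheodory)
  moreover have "V ** R 0 = 0"
    by (simp add: R_def r_def vec_eq_iff matrix_matrix_mult_def)
  ultimately show ?thesis by (rule that)
qed

lemma diagonal_ode_unique:
  fixes w :: "real \<Rightarrow> real^'n"
  assumes w: "caratheodory_solution (\<lambda>t \<xi>. diag lam *v \<xi>) w" and w0: "w 0 = (\<chi> i. 1)"
    and t: "t \<ge> 0"
  shows "w t = (\<chi> i. exp (lam $ i * t))"
proof -
  \<comment> \<open>The negative of the expected solution, so that the difference is a sum of two solutions.\<close>
  define e where "e t = (\<chi> i. - exp (lam $ i * t))" for t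
  have diag_e: "diag lam *v e t = (\<chi> i. - exp (lam $ i * t) * lam $ i)" for t
    by (simp add: diag_mult_vec e_def vec_eq_iff mult.commute)
  have "caratheodory_solution (\<lambda>t \<xi>. diag lam *v \<xi>) e"
  proof (rule classical_imp_caratheodory)
    show "(e has_vector_derivative diag lam *v e t) (at t within {0..b})" for t b
    proof (rule has_vector_derivative_vecI)
      fix i
      show "((\<lambda>t. e t $ i) has_vector_derivative (diag lam *v e t) $ i) (at t within {0..b})"
        unfolding diag_e
        unfolding e_def has_real_derivative_iff_has_vector_derivative[symmetric] vec_lambda_beta
        by (rule derivative_eq_intros refl | simp)+
    qed
    show "continuous_on {0..b} (\<lambda>t. diag lam *v e t)" for b
      unfolding diag_e by (intro continuous_intros)
  qed
  then have "caratheodory_solution (\<lambda>t. (*v) (diag lam)) (\<lambda>t. w t + e t)"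
    by (rule caratheodory_add[OF w]) (simp add: matrix_vector_right_distrib)
  then have "w t + e t = 0"
    by (rule caratheodory_linear_zero[OF _ matrix_vector_mul_bounded_linear _ t])
      (simp add: w0 e_def vec_eq_iff)
  then show ?thesis
    by (simp add: e_def vec_eq_iff add_eq_0_iff)
qed

section \<open>Block structure of the filter and the extended system\<close>

definition upper_block :: "real^('a::finite + 'b::finite) \<Rightarrow> real^'a" where
  "upper_block v = (\<chi> i. v $ Inl i)"

definition lower_block :: "real^('a::finite + 'b::finite) \<Rightarrow> real^'b" where
  "lower_block v = (\<chi> i. v $ Inr i)"

lemma append_vec_blocks: "append_vec (upper_block v) (lower_block v) = v"
  by (simp add: vec_eq_iff append_vec_def upper_block_def lower_block_def split: sum.split)

lemma upper_block_append_vec [simp]: "upper_block (append_vec v w) = v"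
  and lower_block_append_vec [simp]: "lower_block (append_vec v w) = w"
  by (simp_all add: vec_eq_iff append_vec_def upper_block_def lower_block_def)

lemma append_vec_add: "append_vec v w + append_vec v' w' = append_vec (v + v') (w + w')"
  by (simp add: vec_eq_iff append_vec_def split: sum.split)

lemma vstack_mult_vec: "vstack X Y *v v = append_vec (X *v v) (Y *v v)"
  by (simp add: vec_eq_iff vstack_def append_vec_def matrix_vector_mult_def split: sum.split)

lemma hstack_mult_append_vec: "hstack X Y *v append_vec v w = X *v v + Y *v w"
  by (simp add: vec_eq_iff hstack_def append_vec_def matrix_vector_mult_def
      sum.Plus flip: UNIV_Plus_UNIV)

definition unstack :: "real^('l::finite \<times> 'k::finite) \<Rightarrow> real^'l^'k" where
  "unstack z = (\<chi> k l. z $ (l, k))"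

lemma vec_stack_unstack [simp]: "vec_stack (unstack z) = z"
  and unstack_vec_stack [simp]: "unstack (vec_stack X) = X"
  by (simp_all add: vec_eq_iff vec_stack_def unstack_def)

lemma bounded_linear_lower_block: "bounded_linear (lower_block :: real^('a::finite + 'b::finite) \<Rightarrow> real^'b)"
  unfolding linear_conv_bounded_linear[symmetric]
  by (intro linearI) (simp_all add: lower_block_def vec_eq_iff)

lemma bounded_linear_unstack_upper_block:
  "bounded_linear (\<lambda>v :: real^(('l::finite \<times> 'k::finite) + 'b::finite). unstack (upper_block v))"
  unfolding linear_conv_bounded_linear[symmetric]
  by (intro linearI) (simp_all add: upper_block_def unstack_def vec_eq_iff)

lemma regressor_nth:
  fixes y :: "real^'p" and u :: "real^'m"
  defines "G \<equiv> (regressor y u :: real^(('n::finite, 'm::finite, 'p::finite) filter_col)^'n)"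
  shows "G $ k $ Inl (a, j) = (if k = j then y $ a else 0)"
    and "G $ k $ Inr (b, j) = (if k = j then u $ b else 0)"
  by (simp_all add: G_def regressor_def reindex_def hstack_def append_vec_def kron_def rowvector_def
      mat_def)

lemma filter_col_eqI:
  fixes X Y :: "real^(('n::finite, 'm::finite, 'p::finite) filter_col)^'n"
  assumes "\<And>k a j. X $ k $ Inl (a, j) = Y $ k $ Inl (a, j)"
    and "\<And>k b j. X $ k $ Inr (b, j) = Y $ k $ Inr (b, j)"
  shows "X = Y"
  using assms by (simp add: vec_eq_iff split_sum_all split_paired_all)

lemma regressor_add: "regressor y u + regressor y' u' = regressor (y + y') (u + u')"
  by (rule filter_col_eqI) (simp_all add: regressor_nth)

lemma bounded_linear_regressor_output:
  "bounded_linear (\<lambda>y. regressor y 0 :: real^(('n::finite, 'm::finite, 'p::finite) filter_col)^'n)"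
  unfolding linear_conv_bounded_linear[symmetric]
  by (intro linearI; rule filter_col_eqI) (simp_all add: regressor_nth)

text \<open>An instance of \<open>(\<theta>\<^sup>T \<otimes> N) vec(Z) = N Z \<theta>\<close>.\<close>

lemma C_xi_mult_vec_stack:
  "C_xi C T \<theta> *v vec_stack Z = C *v (matrix_inv T *v (Z *v \<theta>))"
proof -
  let ?R = "reindex (\<lambda>i. (1::1, i)) id (kron (rowvector \<theta>) (matrix_inv T))"
  have "(?R *v vec_stack Z) $ i = (matrix_inv T *v (Z *v \<theta>)) $ i" for i
  proof -
    have "(?R *v vec_stack Z) $ i =
      (\<Sum>j\<in>UNIV \<times> UNIV. \<theta> $ fst j * matrix_inv T $ i $ snd j * Z $ snd j $ fst j)"
      by (simp add: reindex_def kron_def rowvector_def matrix_vector_mult_def vec_stack_def)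
    also have "\<dots> = (\<Sum>c\<in>UNIV. \<Sum>k\<in>UNIV. \<theta> $ c * matrix_inv T $ i $ k * Z $ k $ c)"
      by (simp add: sum.cartesian_product split_beta)
    also have "\<dots> = (\<Sum>k\<in>UNIV. \<Sum>c\<in>UNIV. \<theta> $ c * matrix_inv T $ i $ k * Z $ k $ c)"
      by (rule sum.swap)
    also have "\<dots> = (matrix_inv T *v (Z *v \<theta>)) $ i"
      by (simp add: matrix_vector_mult_def sum_distrib_left mult_ac)
    finally show ?thesis .
  qed
  then have "?R *v vec_stack Z = matrix_inv T *v (Z *v \<theta>)"
    by (simp add: vec_eq_iff)
  then show ?thesis
    by (simp only: C_xi_def matrix_vector_mul_assoc[symmetric])
qed

lemma C_zeta_mult_vec:
  "C_zeta C T \<theta> \<Gamma> *v \<xi> =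
    C *v (matrix_inv T *v (unstack (upper_block \<xi>) *v \<theta> + \<Gamma> *v lower_block \<xi>))"
proof -
  have "C_zeta C T \<theta> \<Gamma> *v \<xi> = C_xi C T \<theta> *v vec_stack (unstack (upper_block \<xi>))
      + (C ** matrix_inv T ** \<Gamma>) *v lower_block \<xi>"
    by (subst append_vec_blocks[of \<xi>, symmetric])
      (simp only: C_zeta_def hstack_mult_append_vec vec_stack_unstack)
  then show ?thesis
    by (simp only: C_xi_mult_vec_stack matrix_vector_right_distrib matrix_vector_mul_assoc[symmetric])
qed

text \<open>
  The terms \<open>L\<^sub>z C\<^sub>\<xi> z\<close> in \<open>A\<^sub>\<xi> z\<close> and \<open>L\<^sub>z C T\<inverse> \<Gamma> w\<close> add up to \<open>L\<^sub>z y\<^sub>\<zeta>\<close>: in the upper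
  block, the extended system is the filter with its own output fed back in place of the plant
  output.
\<close>

lemma extended_system_blocks:
  fixes \<xi> :: "real^(('n::finite, 'm::finite, 'p::finite) filter_ix + 'n)" and u :: "real^'m"
  shows "A_zeta M C T \<theta> \<Lambda> \<Gamma> *v \<xi> + B_zeta *v u =
    append_vec
      (vec_stack (M ** unstack (upper_block \<xi>) + regressor (C_zeta C T \<theta> \<Gamma> *v \<xi>) u))
      (\<Lambda> *v lower_block \<xi>)"
proof -
  define z where "z = upper_block \<xi>"
  define w where "w = lower_block \<xi>"
  have \<xi>: "\<xi> = append_vec z w" by (simp add: z_def w_def append_vec_blocks)
  have "A_xi M C T \<theta> *v z + (L_z ** C ** matrix_inv T ** \<Gamma>) *v w + B_xi *v u
      = A_z M *v z + B_xi *v u + L_z *v (C_xi C T \<theta> *v z + (C ** matrix_inv T ** \<Gamma>) *v w)"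
    by (simp add: A_xi_def matrix_vector_mult_add_rdistrib matrix_vector_right_distrib
        matrix_vector_mul_assoc matrix_mul_assoc)
  also have "\<dots> = vec_stack (M ** unstack z + regressor (C_zeta C T \<theta> \<Gamma> *v \<xi>) u)"
    by (simp add: vec_stack_filter \<xi> C_zeta_def hstack_mult_append_vec)
  finally show ?thesis
    unfolding z_def[symmetric] w_def[symmetric]
    by (simp add: A_zeta_def B_zeta_def vstack_mult_vec hstack_mult_append_vec append_vec_add \<xi>)
qed

lemma extended_solution_blocks:
  fixes u :: "real \<Rightarrow> real^'m" and \<zeta> :: "real \<Rightarrow> real^(('n::finite, 'm::finite, 'p::finite) filter_ix + 'n)"
  assumes "linear_solution (A_zeta M C T \<theta> \<Lambda> \<Gamma>) B_zeta u \<zeta>"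
  shows "filter_solution M (\<lambda>t. C_zeta C T \<theta> \<Gamma> *v \<zeta> t) u (\<lambda>t. unstack (upper_block (\<zeta> t)))"
    and "caratheodory_solution (\<lambda>t \<xi>. \<Lambda> *v \<xi>) (\<lambda>t. lower_block (\<zeta> t))"
  using assms unfolding linear_solution_def extended_system_blocks filter_solution_def
  by (auto intro: caratheodory_linear_image[OF _ bounded_linear_unstack_upper_block]
      caratheodory_linear_image[OF _ bounded_linear_lower_block])

lemma matrix_inv_left_vec:
  fixes T :: "real^'n^'n"
  assumes "invertible T"
  shows "matrix_inv T *v (T *v x) = x"
proof -
  have "matrix_inv T ** T = mat 1"
    using someI_ex[OF assms[unfolded invertible_def]] unfolding matrix_inv_def by blast
  then show ?thesis by (simp add: matrix_vector_mul_assoc)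
qed

section \<open>Output equality for the extended system\<close>

theorem lemma4:
  fixes A :: "real^'n^'n" and B :: "real^'m^'n" and C :: "real^'n^'p"
    and M T :: "real^'n^'n" and \<theta> :: "real^(('n, 'm, 'p) filter_col)"
    and lam :: "real^'n"
  assumes "controllable A B" and "observable C A"
    and "hurwitz M"
    and "inj (\<lambda>i. lam $ i)"
    and "complex_spectrum M = range (\<lambda>i. complex_of_real (lam $ i))"
    and "invertible T"
    and "\<forall>u x Z. linear_solution A B u x \<longrightarrow> filter_solution M (\<lambda>t. C *v x t) u Z \<longrightarrow>
           (\<forall>t\<ge>0. T *v x t = Z t *v \<theta> + mat_exp (t *\<^sub>R M) *v (T *v x 0 - Z 0 *v \<theta>))"
  shows "\<forall>x\<^sub>0. \<exists>\<Gamma> :: real^'n^'n. \<forall>u x \<zeta>.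
           linear_solution A B u x \<longrightarrow> x 0 = x\<^sub>0 \<longrightarrow>
           linear_solution (A_zeta M C T \<theta> (diag lam) \<Gamma>) B_zeta u \<zeta> \<longrightarrow>
           \<zeta> 0 = append_vec 0 (\<chi> i. 1) \<longrightarrow>
           (\<forall>t\<ge>0. C_zeta C T \<theta> \<Gamma> *v \<zeta> t = C *v x t)"
proof
  fix x\<^sub>0 :: "real^'n"
  obtain V W :: "real^'n^'n" where VW: "V ** W = mat 1" and WV: "W ** V = mat 1"
    and M: "M = V ** diag lam ** W"
    using distinct_real_eigenvalues_diagonalize[OF assms(4)] assms(5) by (metis subset_refl)
  define q where "q = W *v (T *v x\<^sub>0)"
  define \<Gamma> where "\<Gamma> = V ** diag q"
  have \<Gamma>: "\<Gamma> *v (\<chi> i. exp (lam $ i * t)) = mat_exp (t *\<^sub>R M) *v (T *v x\<^sub>0)" for t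
  proof -
    have "t *\<^sub>R M = V ** diag (t *\<^sub>R lam) ** W"
      using linear_scale[OF bounded_linear.linear[OF bounded_linear_compose[OF
            bounded_linear_matrix_mult_right[of W] bounded_linear_compose[OF
            bounded_linear_matrix_mult_left[of V] bounded_linear_diag]]], of t lam]
      by (simp add: M)
    then have "mat_exp (t *\<^sub>R M) *v (T *v x\<^sub>0) = V *v (diag (\<chi> i. exp (t * lam $ i)) *v q)"
      by (simp add: mat_exp_diagonalized[OF VW WV] q_def matrix_vector_mul_assoc matrix_mul_assoc)
    also have "diag (\<chi> i. exp (t * lam $ i)) *v q = diag q *v (\<chi> i. exp (lam $ i * t))"
      by (simp add: diag_mult_vec mult.commute)
    finally show ?thesis
      by (simp add: \<Gamma>_def matrix_vector_mul_assoc)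
  qed
  have "C_zeta C T \<theta> \<Gamma> *v \<zeta> t = C *v x t"
    if x: "linear_solution A B u x" and x0: "x 0 = x\<^sub>0"
      and \<zeta>: "linear_solution (A_zeta M C T \<theta> (diag lam) \<Gamma>) B_zeta u \<zeta>"
      and \<zeta>0: "\<zeta> 0 = append_vec 0 (\<chi> i. 1)" and t: "t \<ge> 0" for u x \<zeta> t
  proof -
    define Y where "Y s = unstack (upper_block (\<zeta> s))" for s
    define w where "w s = lower_block (\<zeta> s)" for s
    define e where "e s = C *v x s - C_zeta C T \<theta> \<Gamma> *v \<zeta> s" for s
    have Y: "filter_solution M (\<lambda>s. C_zeta C T \<theta> \<Gamma> *v \<zeta> s) u Y"
      and wsol: "caratheodory_solution (\<lambda>s \<xi>. diag lam *v \<xi>) w"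
      unfolding Y_def[abs_def] w_def[abs_def] by (rule extended_solution_blocks[OF \<zeta>])+
    have w: "w s = (\<chi> i. exp (lam $ i * s))" if "s \<ge> 0" for s
      by (rule diagonal_ode_unique[OF wsol _ that]) (simp add: w_def \<zeta>0)
    have Y0: "Y 0 = 0"
      by (simp add: Y_def \<zeta>0 unstack_def vec_eq_iff)
    \<comment> \<open>The input, which need not be continuous, enters neither output directly.\<close>
    have "continuous_on {0..b} e" for b
      unfolding e_def using x \<zeta> unfolding linear_solution_def
      by (intro continuous_on_diff bounded_linear.continuous_on[OF matrix_vector_mul_bounded_linear]
          caratheodory_continuous)
    then have "continuous_on {0..b} (\<lambda>s. regressor (e s) 0 :: real^(('n, 'm, 'p) filter_col)^'n)" for b
      by (rule bounded_linear.continuous_on[OF bounded_linear_regressor_output])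
    from matrix_ode_continuous_forcing[OF VW WV this, of lam]
    obtain D :: "real \<Rightarrow> real^(('n, 'm, 'p) filter_col)^'n"
      where D: "caratheodory_solution (\<lambda>s X. M ** X + regressor (e s) 0) D" and D0: "D 0 = 0"
      unfolding M by blast
    have "filter_solution M (\<lambda>s. C *v x s) u (\<lambda>s. Y s + D s)"
      unfolding filter_solution_def
    proof (rule caratheodory_add[OF Y[unfolded filter_solution_def] D])
      fix s
      have "regressor (C_zeta C T \<theta> \<Gamma> *v \<zeta> s) (u s) + regressor (e s) 0
          = (regressor (C *v x s) (u s) :: real^(('n, 'm, 'p) filter_col)^'n)"
        by (simp add: regressor_add e_def)
      then show "M ** (Y s + D s) + regressor (C *v x s) (u s)
          = M ** Y s + regressor (C_zeta C T \<theta> \<Gamma> *v \<zeta> s) (u s) + (M ** D s + regressor (e s) 0)"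
        by (simp add: matrix_add_ldistrib add_ac)
    qed
    with assms(7) x have "T *v x s = (Y s + D s) *v \<theta> +
        mat_exp (s *\<^sub>R M) *v (T *v x 0 - (Y 0 + D 0) *v \<theta>)" if "s \<ge> 0" for s
      using that by blast
    then have Tx: "T *v x s = (Y s *v \<theta> + \<Gamma> *v w s) + D s *v \<theta>" if "s \<ge> 0" for s
      using that by (simp add: Y0 D0 x0 w \<Gamma> matrix_vector_mult_add_rdistrib)
    have e: "e s = C *v (matrix_inv T *v (D s *v \<theta>))" if "s \<ge> 0" for s
    proof -
      have "x s = matrix_inv T *v (Y s *v \<theta> + \<Gamma> *v w s) + matrix_inv T *v (D s *v \<theta>)"
        using Tx[OF that] matrix_inv_left_vec[OF assms(6), of "x s"]
        by (simp add: matrix_vector_right_distrib)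
      then have "C *v x s = C *v (matrix_inv T *v (Y s *v \<theta> + \<Gamma> *v w s))
          + C *v (matrix_inv T *v (D s *v \<theta>))"
        by (simp only: matrix_vector_right_distrib)
      then show ?thesis
        by (simp add: e_def C_zeta_mult_vec Y_def w_def)
    qed
    \<comment> \<open>The forcing of \<open>D\<close> is now a linear function of \<open>D\<close> itself.\<close>
    let ?F = "\<lambda>X. M ** X + regressor (C *v (matrix_inv T *v (X *v \<theta>))) 0
      :: real^(('n, 'm, 'p) filter_col)^'n"
    have "caratheodory_solution (\<lambda>s. ?F) D"
      by (rule caratheodory_linear_image[OF D bounded_linear_ident]) (simp add: e)
    moreover have "bounded_linear (\<lambda>X :: real^(('n, 'm, 'p) filter_col)^'n. X *v \<theta>)"
      unfolding linear_conv_bounded_linear[symmetric]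
      by (intro linearI) (simp_all add: matrix_vector_mult_add_rdistrib scaleR_matrix_vector_assoc)
    then have "bounded_linear ?F"
      by (intro bounded_linear_add bounded_linear_matrix_mult_left
          bounded_linear_compose[OF bounded_linear_regressor_output]
          bounded_linear_compose[OF matrix_vector_mul_bounded_linear])
    ultimately have "D t = 0"
      using D0 t by (rule caratheodory_linear_zero)
    then have "e t = 0"
      using e[OF t] by simp
    then show ?thesis by (simp add: e_def)
  qed
  then show "\<exists>\<Gamma> :: real^'n^'n. \<forall>u x \<zeta>.
           linear_solution A B u x \<longrightarrow> x 0 = x\<^sub>0 \<longrightarrow>
           linear_solution (A_zeta M C T \<theta> (diag lam) \<Gamma>) B_zeta u \<zeta> \<longrightarrow>
           \<zeta> 0 = append_vec 0 (\<chi> i. 1) \<longrightarrow>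
           (\<forall>t\<ge>0. C_zeta C T \<theta> \<Gamma> *v \<zeta> t = C *v x t)"
    by blast
qed

end
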